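(* Let $1\le p<\infty$ and let $f\in B\mathcal S^p$ have a Fourier series of the symmetric form $\sum_{k\in\mathbb Z}A_k(f)e^{i\lambda_kx}$. Let $\tau>0$ and let $\varphi\in\Phi$ be nondecreasing on $[0,\tau]$ with $\varphi(\tau)=\max\{\varphi(t):t\in\mathbb R\}$. Then for any $n\in\mathbb N$ $$\omega_\varphi^p\Big(f,\frac{\tau}{\lambda_n}\Big)_p\le\sum_{\nu=1}^n\Big(\varphi^p\Big(\frac{\tau\lambda_\nu}{\lambda_n}\Big)-\varphi^p\Big(\frac{\tau\lambda_{\nu-1}}{\lambda_n}\Big)\Big)E_{\lambda_\nu}^p(f)_p.$$
   Context: Almost periodic functions. A locally Lebesgue integrable $f:\mathbb R\to\mathbb C$ is a $B$-a.p. (Besicovitch almost periodic of order 1) function if there are trigonometric sums $\tau_N$ (finite sums $\sum_j a_je^{i\mu_jx}$, $a_j\in\mathbb C$, $\mu_j\in\mathbb R$) with $\lim_{N\to\infty}\limsup_{T\to\infty}\frac1{2T}\int_{-T}^T|f(x)-\tau_N(x)|\,dx=0$. For such $f$ the mean $M\{f\}=\lim_{T\to\infty}\frac1T\int_0^Tf(x)\,dx$ exists. Put $A_\lambda(f)=M\{f(\cdot)e^{-i\lambda\cdot}\}$, $\lambda\in\mathbb R$; this is nonzero for at most countably many $\lambda$, called the Fourier exponents of $f$. For $1\le p<\infty$, $B\mathcal S^p$ is the space of all $B$-a.p. functions with $\|f\|_p:=\big(\sum_\lambda|A_\lambda(f)|^p\big)^{1/p}<\infty$ (sum over Fourier exponents);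 functions with the same Fourier series are identified. Symmetric form. Only functions whose Fourier exponents have a single limit point, at infinity, are considered. Their Fourier series is written $\sum_{k\in\mathbb Z}A_ke^{i\lambda_kx}$, $A_k=A_k(f)=M\{f(\cdot)e^{-i\lambda_k\cdot}\}$, where $\lambda_0=0$, $\lambda_{-k}=-\lambda_k$, $\lambda_{k+1}>\lambda_k>0$ and $|A_k|+|A_{-k}|>0$ for $k>0$ (so $\lambda_k\to\infty$). Best approximation. $E_{\lambda_n}(f)_p=\inf_{g\in G_{\lambda_n}}\|f-g\|_p$, where $G_{\lambda_n}$ is the set of all $B$-a.p. functions whose Fourier exponents lie in $(-\lambda_n,\lambda_n)$. Generalized modulus of smoothness. $\Phi$ is the set of all continuous nonnegative even functions $\varphi$ on $\mathbb R$ with $\varphi(0)=0$ and such that $\{t\in\mathbb R:\varphi(t)=0\}$ has Lebesgue measure zero. For $\varphi\in\Phi$, $\omega_\varphi(f,\delta)_p=\sup_{|h|\le\delta}\big(\sum_{k\in\mathbb Z}\varphi^p(\lambda_kh)|A_k(f)|^p\big)^{1/p}$, $\delta\ge0$. *)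

theory Defs
  imports "HOL-Analysis.Analysis"
begin

definition trig_sum :: "(real \<Rightarrow> complex) \<Rightarrow> bool" where
  "trig_sum \<theta> \<longleftrightarrow>
     (\<exists>(S :: real set) (c :: real \<Rightarrow> complex). finite S \<and>
        \<theta> = (\<lambda>x. \<Sum>\<mu>\<in>S. c \<mu> * exp (\<i> * of_real (\<mu> * x))))"

definition locally_lebesgue_integrable :: "(real \<Rightarrow> complex) \<Rightarrow> bool" where
  "locally_lebesgue_integrable f \<longleftrightarrow> (\<forall>a b. set_integrable lebesgue {a..b} f)"

definition B_ap :: "(real \<Rightarrow> complex) \<Rightarrow> bool" where
  "B_ap f \<longleftrightarrow> locally_lebesgue_integrable f \<and>
     (\<exists>\<theta> :: nat \<Rightarrow> real \<Rightarrow> complex. (\<forall>N. trig_sum (\<theta> N)) \<and>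
        (\<lambda>N. Limsup at_top
               (\<lambda>T :: real. ereal (1 / (2 * T) *
                  (LINT x:{-T..T}|lebesgue. cmod (f x - \<theta> N x)))))
          \<longlonglongrightarrow> 0)"

definition mean :: "(real \<Rightarrow> complex) \<Rightarrow> complex" where
  "mean f = Lim at_top (\<lambda>T :: real. (LINT x:{0..T}|lebesgue. f x) / of_real T)"

definition fourier_coeff :: "(real \<Rightarrow> complex) \<Rightarrow> real \<Rightarrow> complex" where
  "fourier_coeff f l = mean (\<lambda>x. f x * exp (- \<i> * of_real (l * x)))"

definition fourier_exponents :: "(real \<Rightarrow> complex) \<Rightarrow> real set" where
  "fourier_exponents f = {l. fourier_coeff f l \<noteq> 0}"

text \<open>Real powers of extended nonnegative reals, used with positive exponents only.\<close>

definition enn_powr :: "ennreal \<Rightarrow> real \<Rightarrow> ennreal" where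
  "enn_powr x a = (if x = \<infinity> then \<infinity> else ennreal (enn2real x powr a))"

text \<open>The norm is extended-valued because the best approximation below ranges over all
  almost periodic \<open>g\<close>, for which \<open>f - g\<close> may have infinite norm. It depends on
  the Fourier coefficients only, so functions with the same Fourier series need not be
  identified explicitly.\<close>

definition BS_norm :: "real \<Rightarrow> (real \<Rightarrow> complex) \<Rightarrow> ennreal" where
  "BS_norm p f =
     enn_powr (\<Sum>\<^sub>\<infinity>l\<in>fourier_exponents f. ennreal (cmod (fourier_coeff f l) powr p)) (1 / p)"

definition BS :: "real \<Rightarrow> (real \<Rightarrow> complex) set" where
  "BS p = {f. B_ap f \<and> BS_norm p f < \<infinity>}"

text \<open>The Fourier series of \<open>f\<close> is \<open>\<Sum>k\<in>\<int>. A\<^sub>k exp (\<i> \<lambda>\<^sub>k x)\<close> with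
  \<open>A\<^sub>k = fourier_coeff f (lam k)\<close>. The first two conjuncts say that infinity is the only limit
  point of the Fourier exponents. The coefficient \<open>A\<^sub>0\<close>, and one of \<open>A\<^sub>k\<close>, \<open>A\<^sub>-\<^sub>k\<close>
  for each \<open>k > 0\<close>, may vanish.\<close>

definition symmetric_fourier_form :: "(real \<Rightarrow> complex) \<Rightarrow> (int \<Rightarrow> real) \<Rightarrow> bool" where
  "symmetric_fourier_form f lam \<longleftrightarrow>
     (\<forall>x. \<not> x islimpt fourier_exponents f) \<and>
     \<not> bounded (fourier_exponents f) \<and>
     fourier_exponents f \<subseteq> range lam \<and>
     lam 0 = 0 \<and>
     (\<forall>k. lam (- k) = - lam k) \<and>
     (\<forall>k>0. lam (k + 1) > lam k \<and> lam k > 0) \<and>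
     (\<forall>k>0. cmod (fourier_coeff f (lam k)) + cmod (fourier_coeff f (lam (- k))) > 0)"

definition G_space :: "real \<Rightarrow> (real \<Rightarrow> complex) set" where
  "G_space \<sigma> = {g. B_ap g \<and> fourier_exponents g \<subseteq> {- \<sigma> <..< \<sigma>}}"

definition best_approx :: "real \<Rightarrow> real \<Rightarrow> (real \<Rightarrow> complex) \<Rightarrow> ennreal" where
  "best_approx p \<sigma> f = (INF g\<in>G_space \<sigma>. BS_norm p (\<lambda>x. f x - g x))"

definition Phi :: "(real \<Rightarrow> real) set" where
  "Phi = {\<phi>. continuous_on UNIV \<phi> \<and> (\<forall>t. \<phi> t \<ge> 0) \<and> (\<forall>t. \<phi> (- t) = \<phi> t) \<and> \<phi> 0 = 0 \<and>
             {t. \<phi> t = 0} \<in> null_sets lebesgue}"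

definition gen_modulus ::
  "(real \<Rightarrow> real) \<Rightarrow> real \<Rightarrow> (int \<Rightarrow> real) \<Rightarrow> (real \<Rightarrow> complex) \<Rightarrow> real \<Rightarrow> ennreal" where
  "gen_modulus \<phi> p lam f \<delta> =
     (SUP h\<in>{h. \<bar>h\<bar> \<le> \<delta>}.
        enn_powr (\<Sum>\<^sub>\<infinity>k. ennreal (\<phi> (lam k * h) powr p * cmod (fourier_coeff f (lam k)) powr p))
          (1 / p))"

end

theory Submission
  imports Defs
begin

text \<open>
  A Fourier coefficient of a \<open>B\<close>-almost periodic function is an honest limit, hence additive in the
  function. Subtracting from \<open>f\<close> any \<open>g\<close> with spectrum in \<open>(-\<sigma>, \<sigma>)\<close> therefore leaves all
  coefficients of \<open>f\<close> at frequencies \<open>\<bar>l\<bar> \<ge> \<sigma>\<close> unchanged. Writing \<open>E(\<sigma>)\<close> for the best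
  approximation, \<open>E(\<sigma>)\<^sup>p\<close> thus dominates the tail \<open>\<Sum>\<bar>l\<bar>\<ge>\<sigma>. \<bar>A\<^sub>l\<bar>\<^sup>p\<close> (lemma
  \<open>sum_coeff_le_best_approx\<close>).

  On the other side, put \<open>b\<^sub>\<nu> = \<phi>\<^sup>p(\<tau> \<lambda>\<^sub>\<nu> / \<lambda>\<^sub>n)\<close>. When \<open>\<bar>h\<bar> \<le> \<tau> / \<lambda>\<^sub>n\<close>, monotonicity of \<open>\<phi>\<close> on
  \<open>[0, \<tau>]\<close> (for \<open>\<bar>k\<bar> \<le> n\<close>) and maximality of \<open>\<phi>(\<tau>)\<close> (for \<open>\<bar>k\<bar> > n\<close>) give
  \<open>\<phi>\<^sup>p(\<lambda>\<^sub>k h) \<le> b\<^sub>m\<close> with \<open>m = min n \<bar>k\<bar>\<close>. As \<open>b\<^sub>0 = 0\<close>, the right-hand side is the sum of the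
  nonnegative increments \<open>b\<^sub>\<nu> - b\<^bsub>\<nu>-1\<^esub>\<close> over \<open>1 \<le> \<nu> \<le> m\<close> (lemma
  \<open>weight_le_sum_increments\<close>). Multiplying by \<open>\<bar>A\<^sub>k\<bar>\<^sup>p\<close>, summing over \<open>k\<close> and exchanging the two
  sums turns the coefficient of each increment into a tail \<open>\<Sum>\<bar>k\<bar>\<ge>\<nu>. \<bar>A\<^sub>k\<bar>\<^sup>p\<close>, that is, into
  something bounded by \<open>E(\<lambda>\<^sub>\<nu>)\<^sup>p\<close>. Only finite partial sums over \<open>k\<close> have to be considered,
  because all terms are nonnegative.
\<close>

section \<open>Means of almost periodic functions\<close>

lemma trig_sum_modulate:
  assumes "trig_sum \<theta>"
  shows "trig_sum (\<lambda>x. \<theta> x * exp (- \<i> * of_real (l * x)))"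
proof -
  obtain S c where S: "finite S" and \<theta>: "\<theta> = (\<lambda>x. \<Sum>\<mu>\<in>S. c \<mu> * exp (\<i> * of_real (\<mu> * x)))"
    using assms unfolding trig_sum_def by blast
  have "\<theta> x * exp (- \<i> * of_real (l * x)) =
      (\<Sum>\<mu>\<in>(\<lambda>\<mu>. \<mu> - l) ` S. c (\<mu> + l) * exp (\<i> * of_real (\<mu> * x)))" for x
  proof -
    have "exp (\<i> * of_real (\<mu> * x)) * exp (- \<i> * of_real (l * x))
        = exp (\<i> * of_real ((\<mu> - l) * x))" for \<mu>
      by (simp add: exp_add [symmetric] algebra_simps)
    then show ?thesis
      by (subst sum.reindex) (auto simp: inj_on_def \<theta> sum_distrib_right mult.assoc)
  qed
  moreover have "finite ((\<lambda>\<mu>. \<mu> - l) ` S)"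
    using S by simp
  ultimately show ?thesis
    unfolding trig_sum_def
    by (intro exI[of _ "(\<lambda>\<mu>. \<mu> - l) ` S"] exI[of _ "\<lambda>\<mu>. c (\<mu> + l)"]) auto
qed

lemma continuous_on_trig_sum:
  assumes "trig_sum \<theta>"
  shows "continuous_on A \<theta>"
  using assms unfolding trig_sum_def by (auto intro!: continuous_intros)

lemma set_integrable_trig_sum:
  assumes "trig_sum \<theta>"
  shows "set_integrable lebesgue {a..b} \<theta>"
  by (intro absolutely_integrable_continuous_real continuous_on_trig_sum assms)

text \<open>For \<open>\<mu> \<noteq> 0\<close> the primitive \<open>exp (\<i> \<mu> x) / (\<i> \<mu>)\<close> is bounded, so the averages tend to \<open>0\<close>; for
  \<open>\<mu> = 0\<close> they are constantly \<open>1\<close>.\<close>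

lemma mean_exp_converges:
  "\<exists>m. ((\<lambda>T::real. (LINT x:{0..T}|lebesgue. exp (\<i> * of_real (\<mu> * x))) / of_real T) \<longlongrightarrow> m) at_top"
proof (cases "\<mu> = 0")
  case True
  have "(LINT x:{0..T}|lebesgue. exp (\<i> * of_real (\<mu> * x))) / of_real T = 1" if "T > 0" for T :: real
    using that True by (simp add: set_lebesgue_integral_def scaleR_conv_of_real)
  then have "\<forall>\<^sub>F T in at_top. (LINT x:{0..T}|lebesgue. exp (\<i> * of_real (\<mu> * x))) / of_real T = 1"
    by (rule eventually_mono[OF eventually_gt_at_top[of 0]])
  then show ?thesis
    by (intro exI[of _ 1] tendsto_eventually)
next
  case False
  have bound: "cmod ((LINT x:{0..T}|lebesgue. exp (\<i> * of_real (\<mu> * x))) / of_real T) \<le> 2 / \<bar>\<mu>\<bar> / T"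
    if "T > 0" for T :: real
  proof -
    let ?F = "\<lambda>x::real. exp (\<i> * of_real (\<mu> * x)) / (\<i> * of_real \<mu>)"
    have "set_integrable lebesgue {0..T} (\<lambda>x. exp (\<i> * of_real (\<mu> * x)))"
      by (intro absolutely_integrable_continuous_real continuous_intros)
    then have "(LINT x:{0..T}|lebesgue. exp (\<i> * of_real (\<mu> * x)))
        = integral {0..T} (\<lambda>x. exp (\<i> * of_real (\<mu> * x)))"
      by (rule set_lebesgue_integral_eq_integral)
    also have "\<dots> = ?F T - ?F 0"
    proof (rule integral_unique, rule fundamental_theorem_of_calculus)
      fix x :: real
      have "((\<lambda>z. exp (\<i> * (of_real \<mu> * z)) / (\<i> * of_real \<mu>)) has_field_derivative
          exp (\<i> * (of_real \<mu> * of_real x))) (at (of_real x))"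
        by (rule derivative_eq_intros refl)+ (use False in \<open>simp_all add: field_simps\<close>)
      from has_vector_derivative_real_field[OF this] show "(?F has_vector_derivative exp (\<i> * of_real (\<mu> * x))) (at x within {0..T})"
        by simp
    qed (use that in simp)
    finally have "(LINT x:{0..T}|lebesgue. exp (\<i> * of_real (\<mu> * x))) = ?F T - ?F 0" .
    moreover have "cmod (?F T - ?F 0) \<le> cmod (?F T) + cmod (?F 0)"
      by (rule norm_triangle_ineq4)
    moreover have "\<dots> = 2 / \<bar>\<mu>\<bar>"
      using False by (simp add: norm_divide norm_mult)
    ultimately have "cmod (LINT x:{0..T}|lebesgue. exp (\<i> * of_real (\<mu> * x))) \<le> 2 / \<bar>\<mu>\<bar>"
      by (simp only:)
    then have "cmod (LINT x:{0..T}|lebesgue. exp (\<i> * of_real (\<mu> * x))) / T \<le> 2 / \<bar>\<mu>\<bar> / T"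
      using that by (intro divide_right_mono) auto
    then show ?thesis
      using that by (simp only: norm_divide norm_of_real abs_of_pos)
  qed
  have "((\<lambda>T. 2 / \<bar>\<mu>\<bar> / T) \<longlongrightarrow> 0) at_top"
    by (intro tendsto_divide_0[OF tendsto_const] filterlim_at_top_imp_at_infinity filterlim_ident)
  then have "((\<lambda>T::real. (LINT x:{0..T}|lebesgue. exp (\<i> * of_real (\<mu> * x))) / of_real T) \<longlongrightarrow> 0) at_top"
  proof (rule Lim_null_comparison[rotated])
    show "\<forall>\<^sub>F T in at_top. cmod ((LINT x:{0..T}|lebesgue. exp (\<i> * of_real (\<mu> * x))) / of_real T)
        \<le> 2 / \<bar>\<mu>\<bar> / T"
      using eventually_gt_at_top[of 0] by eventually_elim (rule bound)
  qed
  then show ?thesis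
    by blast
qed

lemma mean_trig_sum_converges:
  assumes "trig_sum \<theta>"
  shows "\<exists>m. ((\<lambda>T::real. (LINT x:{0..T}|lebesgue. \<theta> x) / of_real T) \<longlongrightarrow> m) at_top"
proof -
  obtain S c where S: "finite S" and \<theta>: "\<theta> = (\<lambda>x. \<Sum>\<mu>\<in>S. c \<mu> * exp (\<i> * of_real (\<mu> * x)))"
    using assms unfolding trig_sum_def by blast
  obtain m where m: "((\<lambda>T::real. (LINT x:{0..T}|lebesgue. exp (\<i> * of_real (\<mu> * x))) / of_real T)
      \<longlongrightarrow> m \<mu>) at_top" for \<mu>
    using mean_exp_converges by metis
  have int: "set_integrable lebesgue {0..T} (\<lambda>x. c \<mu> * exp (\<i> * of_real (\<mu> * x)))" for T \<mu>
    by (intro absolutely_integrable_continuous_real continuous_intros)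
  have "(LINT x:{0..T}|lebesgue. \<theta> x) / of_real T =
      (\<Sum>\<mu>\<in>S. c \<mu> * ((LINT x:{0..T}|lebesgue. exp (\<i> * of_real (\<mu> * x))) / of_real T))" for T
  proof -
    have "(LINT x:{0..T}|lebesgue. \<theta> x)
        = (\<Sum>\<mu>\<in>S. LINT x:{0..T}|lebesgue. c \<mu> * exp (\<i> * of_real (\<mu> * x)))"
      unfolding \<theta> set_lebesgue_integral_def scaleR_sum_right
      by (intro Bochner_Integration.integral_sum int[unfolded set_integrable_def])
    then show ?thesis
      by (simp add: sum_divide_distrib)
  qed
  moreover have "((\<lambda>T::real. \<Sum>\<mu>\<in>S. c \<mu> * ((LINT x:{0..T}|lebesgue. exp (\<i> * of_real (\<mu> * x))) / of_real T))
      \<longlongrightarrow> (\<Sum>\<mu>\<in>S. c \<mu> * m \<mu>)) at_top"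
    by (intro tendsto_sum tendsto_mult_left m)
  ultimately show ?thesis
    by auto
qed

lemma cmod_mult_unit_exp:
  "cmod (a * exp (- \<i> * of_real (l * x)) - b * exp (- \<i> * of_real (l * x))) = cmod (a - b)"
  by (simp add: left_diff_distrib[symmetric] norm_mult)

text \<open>The character has modulus one, so multiplying both \<open>f\<close> and its approximating sums by it does
  not change the approximation error. Fourier coefficients of \<open>f\<close> thereby become means of almost
  periodic functions.\<close>

lemma B_ap_modulate:
  assumes "B_ap f"
  shows "B_ap (\<lambda>x. f x * exp (- \<i> * of_real (l * x)))"
proof -
  obtain \<theta> where \<theta>: "\<And>N. trig_sum (\<theta> N)"
    and lim: "(\<lambda>N. Limsup at_top (\<lambda>T :: real. ereal (1 / (2 * T) *
        (LINT x:{-T..T}|lebesgue. cmod (f x - \<theta> N x))))) \<longlonglongrightarrow> 0"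
    using assms unfolding B_ap_def by blast
  have "set_integrable lebesgue {a..b} (\<lambda>x. f x * exp (- \<i> * of_real (l * x)))" for a b
  proof -
    have cont: "continuous_on {a..b} (\<lambda>x. exp (- \<i> * of_real (l * x)))"
      by (intro continuous_intros)
    have "(\<lambda>x. exp (- \<i> * of_real (l * x)) * f x) absolutely_integrable_on {a..b}"
    proof (rule absolutely_integrable_bounded_measurable_product[OF bilinear_times])
      show "(\<lambda>x. exp (- \<i> * of_real (l * x))) \<in> borel_measurable (lebesgue_on {a..b})"
        by (intro continuous_imp_measurable_on_sets_lebesgue cont) simp
      show "bounded ((\<lambda>x. exp (- \<i> * of_real (l * x))) ` {a..b})"
        by (intro compact_imp_bounded compact_continuous_image cont) simp
      show "f absolutely_integrable_on {a..b}"
        using assms unfolding B_ap_def locally_lebesgue_integrable_def by blast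
    qed simp
    then show ?thesis
      by (simp add: mult.commute)
  qed
  moreover note trig_sum_modulate[OF \<theta>]
  ultimately show ?thesis
    using lim unfolding B_ap_def locally_lebesgue_integrable_def
    by (intro conjI exI[of _ "\<lambda>N x. \<theta> N x * exp (- \<i> * of_real (l * x))"])
      (simp_all only: cmod_mult_unit_exp, auto)
qed

text \<open>The averages over \<open>[0, T]\<close> are controlled by twice the averages over \<open>[-T, T]\<close>; so the averages
  of \<open>f\<close> stay within any prescribed distance of the convergent averages of some trigonometric sum,
  and the Cauchy criterion applies.\<close>

lemma B_ap_mean_converges:
  assumes "B_ap f"
  shows "\<exists>m. ((\<lambda>T::real. (LINT x:{0..T}|lebesgue. f x) / of_real T) \<longlongrightarrow> m) at_top"
proof -
  let ?F = "\<lambda>(g :: real \<Rightarrow> complex) T::real. (LINT x:{0..T}|lebesgue. g x) / of_real T"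
  obtain \<theta> where \<theta>: "\<And>N. trig_sum (\<theta> N)"
    and lim: "(\<lambda>N. Limsup at_top (\<lambda>T :: real. ereal (1 / (2 * T) *
        (LINT x:{-T..T}|lebesgue. cmod (f x - \<theta> N x))))) \<longlonglongrightarrow> 0"
    using assms unfolding B_ap_def by blast
  have f: "set_integrable lebesgue {a..b} f" for a b
    using assms unfolding B_ap_def locally_lebesgue_integrable_def by blast
  have average: "cmod (?F f T - ?F (\<theta> N) T)
      \<le> 2 * (1 / (2 * T) * (LINT x:{-T..T}|lebesgue. cmod (f x - \<theta> N x)))" if "T > 0" for T N
  proof -
    have int: "set_integrable lebesgue {a..b} (\<lambda>x. f x - \<theta> N x)" for a b
      by (intro set_integral_diff f set_integrable_trig_sum \<theta>)
    have "cmod ((LINT x:{0..T}|lebesgue. f x) - (LINT x:{0..T}|lebesgue. \<theta> N x))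
        = cmod (LINT x:{0..T}|lebesgue. f x - \<theta> N x)"
      by (subst set_integral_diff(2)) (auto intro: f set_integrable_trig_sum \<theta>)
    also have "\<dots> \<le> (LINT x:{0..T}|lebesgue. cmod (f x - \<theta> N x))"
      by (rule set_integral_norm_bound[OF int])
    also have "\<dots> \<le> (LINT x:{-T..T}|lebesgue. cmod (f x - \<theta> N x))"
      using set_integrable_norm[OF int[of 0 T]] set_integrable_norm[OF int[of "-T" T]] that
      unfolding set_lebesgue_integral_def set_integrable_def
      by (intro integral_mono) (auto simp: indicator_def)
    finally have "cmod ((LINT x:{0..T}|lebesgue. f x) - (LINT x:{0..T}|lebesgue. \<theta> N x)) / T
        \<le> (LINT x:{-T..T}|lebesgue. cmod (f x - \<theta> N x)) / T"
      using that by (intro divide_right_mono) auto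
    then show ?thesis
      using that by (simp add: diff_divide_distrib[symmetric] norm_divide)
  qed
  have "cauchy_filter (filtermap (?F f) at_top)"
    unfolding cauchy_filter_metric_filtermap
  proof (intro allI impI)
    fix e :: real
    assume "e > 0"
    then have "\<forall>\<^sub>F N in sequentially. Limsup at_top (\<lambda>T :: real. ereal (1 / (2 * T) *
        (LINT x:{-T..T}|lebesgue. cmod (f x - \<theta> N x)))) < ereal (e / 8)"
      by (intro order_tendstoD[OF lim]) auto
    then obtain N where "Limsup at_top (\<lambda>T :: real. ereal (1 / (2 * T) *
        (LINT x:{-T..T}|lebesgue. cmod (f x - \<theta> N x)))) < ereal (e / 8)"
      by (auto simp: eventually_sequentially)
    then have "\<forall>\<^sub>F T in at_top. ereal (1 / (2 * T) *
        (LINT x:{-T..T}|lebesgue. cmod (f x - \<theta> N x))) < ereal (e / 8)"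
      by (rule Limsup_lessD)
    with eventually_gt_at_top[of 0]
    have near: "\<forall>\<^sub>F T in at_top. cmod (?F f T - ?F (\<theta> N) T) < e / 4"
    proof eventually_elim
      case (elim T)
      with average[of T N] show ?case
        by simp
    qed
    obtain m where "(?F (\<theta> N) \<longlongrightarrow> m) at_top"
      using mean_trig_sum_converges[OF \<theta>] by blast
    then have "\<forall>\<^sub>F T in at_top. dist (?F (\<theta> N) T) m < e / 4"
      using \<open>e > 0\<close> by (intro tendstoD) auto
    with near have *: "\<forall>\<^sub>F T in at_top. dist (?F f T) m < e / 2"
    proof eventually_elim
      case (elim T)
      with dist_triangle[of "?F f T" m "?F (\<theta> N) T"] show ?case
        by (simp add: dist_norm)
    qed
    have "dist (?F f S) (?F f T) < e" if "dist (?F f S) m < e / 2" "dist (?F f T) m < e / 2" for S T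
      using dist_triangle_half_l that by blast
    with * show "\<exists>P. eventually P at_top \<and> (\<forall>S T. P S \<and> P T \<longrightarrow> dist (?F f S) (?F f T) < e)"
      by (intro exI[of _ "\<lambda>T. dist (?F f T) m < e / 2"]) blast
  qed
  moreover have "filtermap (?F f) at_top \<noteq> bot"
    by (simp add: filtermap_bot_iff)
  ultimately have "\<exists>m. filtermap (?F f) at_top \<le> nhds m"
    using complete_UNIV[where 'a = complex] unfolding complete_uniform by auto
  then show ?thesis
    by (simp add: filterlim_def)
qed

text \<open>The operator \<open>Lim\<close> is meaningful only for convergent functions; this is what makes the
  limit theorems, and with them additivity, applicable to Fourier coefficients.\<close>

lemma fourier_coeff_tendsto:
  assumes "B_ap f"
  shows "((\<lambda>T::real. (LINT x:{0..T}|lebesgue. f x * exp (- \<i> * of_real (l * x))) / of_real T)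
    \<longlongrightarrow> fourier_coeff f l) at_top"
proof -
  obtain m where m: "((\<lambda>T::real. (LINT x:{0..T}|lebesgue. f x * exp (- \<i> * of_real (l * x))) / of_real T)
      \<longlongrightarrow> m) at_top"
    using B_ap_mean_converges[OF B_ap_modulate[OF assms, of l]] by (elim exE)
  then have "fourier_coeff f l = m"
    unfolding fourier_coeff_def mean_def by (intro tendsto_Lim trivial_limit_at_top_linorder)
  with m show ?thesis
    by (simp only:)
qed

lemma fourier_coeff_diff:
  assumes "B_ap f" "B_ap g"
  shows "fourier_coeff (\<lambda>x. f x - g x) l = fourier_coeff f l - fourier_coeff g l"
proof -
  have int: "set_integrable lebesgue {0..T} (\<lambda>x. u x * exp (- \<i> * of_real (l * x)))"
    if "B_ap u" for u T
    using B_ap_modulate[OF that] unfolding B_ap_def locally_lebesgue_integrable_def by blast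
  have "(LINT x:{0..T}|lebesgue. (f x - g x) * exp (- \<i> * of_real (l * x))) / of_real T
      = (LINT x:{0..T}|lebesgue. f x * exp (- \<i> * of_real (l * x))) / of_real T
        - (LINT x:{0..T}|lebesgue. g x * exp (- \<i> * of_real (l * x))) / of_real T" for T
    unfolding left_diff_distrib
    by (subst set_integral_diff(2)[OF int[OF assms(1)] int[OF assms(2)]]) (simp add: diff_divide_distrib)
  then have "((\<lambda>T::real. (LINT x:{0..T}|lebesgue. (f x - g x) * exp (- \<i> * of_real (l * x))) / of_real T)
      \<longlongrightarrow> fourier_coeff f l - fourier_coeff g l) at_top"
    using tendsto_diff[OF fourier_coeff_tendsto[OF assms(1)] fourier_coeff_tendsto[OF assms(2)]]
    by simp
  then show ?thesis
    unfolding fourier_coeff_def[of "\<lambda>x. f x - g x"] mean_def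
    by (intro tendsto_Lim) auto
qed

section \<open>Best approximation and the tail of the Fourier coefficients\<close>

lemma enn_powr_mono:
  assumes "x \<le> y" "a > 0"
  shows "enn_powr x a \<le> enn_powr y a"
  using assms
  by (auto simp: enn_powr_def top_unique less_top[symmetric] intro!: ennreal_leI powr_mono2 enn2real_mono)

lemma enn_powr_inverse:
  assumes "a > 0"
  shows "enn_powr (enn_powr x (1 / a)) a = x"
  using assms by (auto simp: enn_powr_def powr_powr less_top)

text \<open>A competitor \<open>g\<close> has vanishing coefficients at all \<open>l \<in> L\<close>, so \<open>f - g\<close> has the same
  coefficients there as \<open>f\<close>, and its norm is at least their \<open>\<ell>\<^sup>p\<close> norm. The bound holds for each
  \<open>g\<close>, hence for the infimum.\<close>

lemma sum_coeff_le_best_approx: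
  assumes "B_ap f" "p > 0" "finite L" "\<And>l. l \<in> L \<Longrightarrow> \<sigma> \<le> \<bar>l\<bar>"
  shows "(\<Sum>l\<in>L. ennreal (cmod (fourier_coeff f l) powr p)) \<le> enn_powr (best_approx p \<sigma> f) p"
proof -
  let ?s = "\<Sum>l\<in>L. ennreal (cmod (fourier_coeff f l) powr p)"
  have "enn_powr ?s (1 / p) \<le> best_approx p \<sigma> f"
    unfolding best_approx_def
  proof (rule INF_greatest)
    fix g
    assume "g \<in> G_space \<sigma>"
    then have g: "B_ap g" "fourier_exponents g \<subseteq> {- \<sigma> <..< \<sigma>}"
      by (auto simp: G_space_def)
    let ?c = "fourier_coeff (\<lambda>x. f x - g x)"
    let ?E = "fourier_exponents (\<lambda>x. f x - g x)"
    have "fourier_coeff f l = ?c l" if "l \<in> L" for l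
    proof -
      have "l \<notin> fourier_exponents g"
      proof
        assume "l \<in> fourier_exponents g"
        with g(2) have "- \<sigma> < l" "l < \<sigma>"
          by auto
        with assms(4)[OF that] show False
          by linarith
      qed
      then show ?thesis
        by (simp add: fourier_coeff_diff[OF assms(1) g(1)] fourier_exponents_def)
    qed
    then have "?s = (\<Sum>l\<in>L. ennreal (cmod (?c l) powr p))"
      by simp
    \<comment> \<open>the norm sums over the exponents of \<open>f - g\<close> only; elsewhere the summand is \<open>0 powr p = 0\<close>\<close>
    also have "\<dots> = (\<Sum>l\<in>L \<inter> ?E. ennreal (cmod (?c l) powr p))"
      using assms(3) by (intro sum.mono_neutral_right) (auto simp: fourier_exponents_def)
    also have "\<dots> \<le> (\<Sum>\<^sub>\<infinity>l\<in>?E. ennreal (cmod (?c l) powr p))"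
      using assms(3) by (subst nonneg_infsum_complete) (auto intro!: SUP_upper)
    finally show "enn_powr ?s (1 / p) \<le> BS_norm p (\<lambda>x. f x - g x)"
      unfolding BS_norm_def using assms(2) by (intro enn_powr_mono) auto
  qed
  then have "enn_powr (enn_powr ?s (1 / p)) p \<le> enn_powr (best_approx p \<sigma> f) p"
    using assms(2) by (rule enn_powr_mono)
  then show ?thesis
    using assms(2) by (simp add: enn_powr_inverse)
qed

section \<open>The weights of the modulus of smoothness\<close>

lemma symmetric_fourier_form_abs:
  assumes "symmetric_fourier_form f lam"
  shows "\<bar>lam k\<bar> = lam \<bar>k\<bar>"
proof -
  have "lam j \<ge> 0" if "j \<ge> 0" for j
    using assms that unfolding symmetric_fourier_form_def by (cases "j = 0") (auto simp: less_imp_le)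
  moreover have "lam (- k) = - lam k"
    using assms by (simp add: symmetric_fourier_form_def)
  ultimately show ?thesis
    by (smt (verit))
qed

lemma symmetric_fourier_form_mono:
  assumes "symmetric_fourier_form f lam" "0 \<le> i" "i \<le> j"
  shows "lam i \<le> lam j"
  using \<open>i \<le> j\<close>
proof (induction j rule: int_ge_induct)
  case (step j)
  have "lam j \<le> lam (j + 1)"
  proof (cases "j = 0")
    case True
    have "lam 0 = 0" "lam 1 > 0"
      using assms(1) by (auto simp: symmetric_fourier_form_def)
    with True show ?thesis
      by simp
  next
    case False
    then show ?thesis
      using assms(1,2) step(1) by (force simp: symmetric_fourier_form_def less_imp_le)
  qed
  with step show ?case
    by simp
qed simp

lemma symmetric_fourier_form_inj:
  assumes "symmetric_fourier_form f lam"
  shows "inj lam"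
proof -
  have pos: "lam j < lam (j + 1)" if "j \<ge> 0" for j
    using assms that unfolding symmetric_fourier_form_def by (cases "j = 0") auto
  have less: "lam i < lam j" if "0 \<le> i" "i < j" for i j
    using pos[OF that(1)] symmetric_fourier_form_mono[OF assms, of "i + 1" j] that by simp
  have neg: "lam (- k) = - lam k" for k
    using assms by (simp add: symmetric_fourier_form_def)
  have "lam i < lam j" if "i < j" for i j
  proof -
    consider "0 \<le> i" | "j \<le> 0" | "i < 0" "0 < j"
      by linarith
    then show ?thesis
    proof cases
      case 1
      with less that show ?thesis by blast
    next
      case 2
      with less[of "- j" "- i"] that show ?thesis by (simp add: neg)
    next
      case 3
      with less[of 0 j] less[of 0 "- i"] neg[of 0] show ?thesis by (simp add: neg)
    qed
  qed
  then show ?thesis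
    by (intro strict_mono_imp_inj_on strict_monoI)
qed

lemma sum_increments:
  fixes b :: "int \<Rightarrow> 'a::ab_group_add"
  shows "(\<Sum>\<nu>=1..m. b (int \<nu>) - b (int \<nu> - 1)) = b (int m) - b 0"
  by (induction m) (auto simp: algebra_simps)

text \<open>The index \<open>m = min n \<bar>k\<bar>\<close> covers both regimes at once: below \<open>n\<close> the
  argument \<open>\<bar>\<lambda>\<^sub>k h\<bar>\<close> is at most \<open>\<tau> \<lambda>\<^sub>m / \<lambda>\<^sub>n \<le> \<tau>\<close>, and from \<open>n\<close> on the point
  \<open>\<tau> \<lambda>\<^sub>m / \<lambda>\<^sub>n = \<tau>\<close> is where \<open>\<phi>\<close> is largest.\<close>

lemma weight_le_sum_increments:
  fixes lam :: "int \<Rightarrow> real" and \<tau> :: real and n :: nat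
  assumes form: "symmetric_fourier_form f lam" and \<phi>: "\<phi> \<in> Phi"
    and mono: "mono_on {0..\<tau>} \<phi>" and max: "\<And>t. \<phi> t \<le> \<phi> \<tau>"
    and "n \<ge> 1" "\<tau> > 0" "p > 0" "\<bar>h\<bar> \<le> \<tau> / lam (int n)"
  defines "b \<equiv> \<lambda>j. \<phi> (\<tau> * lam j / lam (int n)) powr p"
  shows "\<And>\<nu>. \<nu> \<in> {1..n} \<Longrightarrow> 0 \<le> b (int \<nu>) - b (int \<nu> - 1)"
    and "\<phi> (lam k * h) powr p
      \<le> (\<Sum>\<nu>=1..n. (b (int \<nu>) - b (int \<nu> - 1)) * (if int \<nu> \<le> \<bar>k\<bar> then 1 else 0))"
proof -
  have pos: "lam (int n) > 0" and zero: "lam 0 = 0"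
    using form \<open>n \<ge> 1\<close> by (auto simp: symmetric_fourier_form_def)
  have nonneg: "\<phi> t \<ge> 0" and even: "\<phi> (- t) = \<phi> t" and "\<phi> 0 = 0" for t
    using \<phi> by (auto simp: Phi_def)
  have lam_nonneg: "lam j \<ge> 0" if "j \<ge> 0" for j
    using symmetric_fourier_form_mono[OF form _ that] zero by simp
  have arg: "\<tau> * lam j / lam (int n) \<in> {0..\<tau>}" if "0 \<le> j" "j \<le> int n" for j
    using pos \<open>\<tau> > 0\<close> lam_nonneg[OF that(1)] symmetric_fourier_form_mono[OF form that]
    by (auto simp: divide_le_eq)
  show "0 \<le> b (int \<nu>) - b (int \<nu> - 1)" if "\<nu> \<in> {1..n}" for \<nu>
  proof -
    have "\<tau> * lam (int \<nu> - 1) / lam (int n) \<le> \<tau> * lam (int \<nu>) / lam (int n)"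
      using that pos \<open>\<tau> > 0\<close> symmetric_fourier_form_mono[OF form, of "int \<nu> - 1" "int \<nu>"]
      by (simp add: divide_right_mono)
    then show ?thesis
      using that arg[of "int \<nu> - 1"] arg[of "int \<nu>"] \<open>p > 0\<close> nonneg mono_onD[OF mono]
      by (auto simp: b_def intro!: powr_mono2)
  qed
  define m where "m = min n (nat \<bar>k\<bar>)"
  have "\<phi> (lam k * h) \<le> \<phi> (\<tau> * lam (int m) / lam (int n))"
  proof (cases "\<bar>k\<bar> \<le> int n")
    case True
    then have m: "int m = \<bar>k\<bar>"
      by (simp add: m_def)
    have "\<bar>lam k * h\<bar> \<le> lam \<bar>k\<bar> * (\<tau> / lam (int n))"
      unfolding abs_mult symmetric_fourier_form_abs[OF form]
      using assms lam_nonneg by (intro mult_left_mono) auto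
    then have le: "\<bar>lam k * h\<bar> \<le> \<tau> * lam (int m) / lam (int n)"
      by (simp add: m mult.commute)
    have "\<phi> (lam k * h) = \<phi> \<bar>lam k * h\<bar>"
      using even by (simp add: abs_if)
    also have "\<dots> \<le> \<phi> (\<tau> * lam (int m) / lam (int n))"
      using le arg[of "int m"] True m by (intro mono_onD[OF mono]) auto
    finally show ?thesis .
  next
    case False
    then have "m = n"
      by (simp add: m_def)
    with max pos show ?thesis
      by simp
  qed
  then have "\<phi> (lam k * h) powr p \<le> b (int m) - b 0"
    using \<open>p > 0\<close> nonneg \<open>\<phi> 0 = 0\<close> zero by (simp add: b_def powr_mono2)
  also have "\<dots> = (\<Sum>\<nu>=1..m. b (int \<nu>) - b (int \<nu> - 1))"
    by (rule sum_increments[symmetric])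
  also have "\<dots> = (\<Sum>\<nu>=1..m. (b (int \<nu>) - b (int \<nu> - 1)) * (if int \<nu> \<le> \<bar>k\<bar> then 1 else 0))"
    by (intro sum.cong) (auto simp: m_def)
  also have "\<dots> = (\<Sum>\<nu>=1..n. (b (int \<nu>) - b (int \<nu> - 1)) * (if int \<nu> \<le> \<bar>k\<bar> then 1 else 0))"
    by (intro sum.mono_neutral_left) (auto simp: m_def)
  finally show "\<phi> (lam k * h) powr p
      \<le> (\<Sum>\<nu>=1..n. (b (int \<nu>) - b (int \<nu> - 1)) * (if int \<nu> \<le> \<bar>k\<bar> then 1 else 0))" .
qed

section \<open>The direct estimate for the modulus of smoothness\<close>

theorem theorem2:
  fixes p \<tau> :: real and f :: "real \<Rightarrow> complex" and lam :: "int \<Rightarrow> real"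
    and \<phi> :: "real \<Rightarrow> real" and n :: nat
  assumes "1 \<le> p"
    and "f \<in> BS p"
    and "symmetric_fourier_form f lam"
    and "\<tau> > 0"
    and "\<phi> \<in> Phi"
    and "mono_on {0..\<tau>} \<phi>"
    and "\<And>t. \<phi> t \<le> \<phi> \<tau>"
    and "n \<ge> 1"
  shows "enn_powr (gen_modulus \<phi> p lam f (\<tau> / lam (int n))) p
    \<le> (\<Sum>\<nu>=1..n. ennreal (\<phi> (\<tau> * lam (int \<nu>) / lam (int n)) powr p
                         - \<phi> (\<tau> * lam (int \<nu> - 1) / lam (int n)) powr p)
                 * enn_powr (best_approx p (lam (int \<nu>)) f) p)"
    (is "_ \<le> ?R")
proof -
  have p: "p > 0" and f: "B_ap f"
    using assms(1,2) by (auto simp: BS_def)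
  define d where "d \<nu> = \<phi> (\<tau> * lam (int \<nu>) / lam (int n)) powr p
    - \<phi> (\<tau> * lam (int \<nu> - 1) / lam (int n)) powr p" for \<nu> :: nat
  define c where "c k = cmod (fourier_coeff f (lam k)) powr p" for k
  have c: "c k \<ge> 0" for k
    by (simp add: c_def)
  have tail: "(\<Sum>k\<in>{k\<in>F. int \<nu> \<le> \<bar>k\<bar>}. ennreal (c k)) \<le> enn_powr (best_approx p (lam (int \<nu>)) f) p"
    if "finite F" for F \<nu>
  proof -
    let ?K = "{k\<in>F. int \<nu> \<le> \<bar>k\<bar>}"
    \<comment> \<open>distinct indices carry distinct frequencies, so no coefficient is counted twice\<close>
    have "(\<Sum>k\<in>?K. ennreal (c k)) = (\<Sum>l\<in>lam ` ?K. ennreal (cmod (fourier_coeff f l) powr p))"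
      using symmetric_fourier_form_inj[OF assms(3)]
      by (subst sum.reindex) (auto simp: c_def intro: inj_on_subset)
    also have "\<dots> \<le> enn_powr (best_approx p (lam (int \<nu>)) f) p"
      using that symmetric_fourier_form_mono[OF assms(3), of "int \<nu>"]
      by (intro sum_coeff_le_best_approx f p) (auto simp: symmetric_fourier_form_abs[OF assms(3)])
    finally show ?thesis .
  qed
  have "gen_modulus \<phi> p lam f (\<tau> / lam (int n)) \<le> enn_powr ?R (1 / p)"
    unfolding gen_modulus_def
  proof (rule SUP_least)
    fix h
    assume "h \<in> {h. \<bar>h\<bar> \<le> \<tau> / lam (int n)}"
    then have h: "\<bar>h\<bar> \<le> \<tau> / lam (int n)"
      by simp
    note weights = weight_le_sum_increments[OF assms(3,5-8,4) p h, folded d_def]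
    have "(\<Sum>\<^sub>\<infinity>k. ennreal (\<phi> (lam k * h) powr p * c k)) \<le> ?R"
    proof (intro infsum_le_finite_sums nonneg_summable_on_complete)
      fix F :: "int set"
      assume F: "finite F"
      have "ennreal (\<phi> (lam k * h) powr p * c k)
          \<le> (\<Sum>\<nu>=1..n. ennreal (d \<nu>) * (if int \<nu> \<le> \<bar>k\<bar> then ennreal (c k) else 0))" for k
      proof -
        have "\<phi> (lam k * h) powr p * c k
            \<le> (\<Sum>\<nu>=1..n. d \<nu> * (if int \<nu> \<le> \<bar>k\<bar> then 1 else 0)) * c k"
          by (intro mult_right_mono weights c)
        also have "\<dots> = (\<Sum>\<nu>=1..n. d \<nu> * (if int \<nu> \<le> \<bar>k\<bar> then c k else 0))"
          unfolding sum_distrib_right by (intro sum.cong) auto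
        finally have "ennreal (\<phi> (lam k * h) powr p * c k)
            \<le> ennreal (\<Sum>\<nu>=1..n. d \<nu> * (if int \<nu> \<le> \<bar>k\<bar> then c k else 0))"
          by (rule ennreal_leI)
        also have "\<dots> = (\<Sum>\<nu>=1..n. ennreal (d \<nu> * (if int \<nu> \<le> \<bar>k\<bar> then c k else 0)))"
          using weights(1) c by (intro sum_ennreal[symmetric]) auto
        also have "\<dots> = (\<Sum>\<nu>=1..n. ennreal (d \<nu>) * (if int \<nu> \<le> \<bar>k\<bar> then ennreal (c k) else 0))"
          using weights(1) c by (intro sum.cong) (auto simp: ennreal_mult)
        finally show ?thesis .
      qed
      then have "(\<Sum>k\<in>F. ennreal (\<phi> (lam k * h) powr p * c k))
          \<le> (\<Sum>k\<in>F. \<Sum>\<nu>=1..n. ennreal (d \<nu>) * (if int \<nu> \<le> \<bar>k\<bar> then ennreal (c k) else 0))"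
        by (intro sum_mono)
      \<comment> \<open>exchanging the sums collects, for each increment, the tail \<open>\<bar>k\<bar> \<ge> \<nu>\<close>\<close>
      also have "\<dots> = (\<Sum>\<nu>=1..n. ennreal (d \<nu>) * (\<Sum>k\<in>{k\<in>F. int \<nu> \<le> \<bar>k\<bar>}. ennreal (c k)))"
        by (subst sum.swap) (simp add: sum_distrib_left[symmetric] sum.inter_filter[OF F])
      also have "\<dots> \<le> (\<Sum>\<nu>=1..n. ennreal (d \<nu>) * enn_powr (best_approx p (lam (int \<nu>)) f) p)"
        by (intro sum_mono mult_left_mono tail F) auto
      finally show "(\<Sum>k\<in>F. ennreal (\<phi> (lam k * h) powr p * c k)) \<le> ?R"
        by (simp add: d_def)
    qed auto
    then show "enn_powr (\<Sum>\<^sub>\<infinity>k. ennreal (\<phi> (lam k * h) powr p *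
        cmod (fourier_coeff f (lam k)) powr p)) (1 / p) \<le> enn_powr ?R (1 / p)"
      using p unfolding c_def by (intro enn_powr_mono) auto
  qed
  then have "enn_powr (gen_modulus \<phi> p lam f (\<tau> / lam (int n))) p \<le> enn_powr (enn_powr ?R (1 / p)) p"
    using p by (rule enn_powr_mono)
  then show ?thesis
    using p by (simp add: enn_powr_inverse)
qed

end
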